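(* Let $G$ be a finite group. Then the order superpower graph $\mathcal{S}(G)$ is minimally connected if and only if $G$ is a $p$-group for some prime $p$.
   Context: The order superpower graph $\mathcal{S}(G)$ of a finite group $G$ is the simple undirected graph with vertex set $G$ in which two distinct vertices are adjacent if and only if the order of one of them divides the order of the other. A finite group $G$ is a $p$-group if $|G|=p^n$ for some integer $n \ge 0$ (with $p$ prime). The vertex connectivity $\kappa(\Gamma)$ of a graph $\Gamma$ is the minimum size of a set $S$ of vertices such that $\Gamma - S$ is disconnected or has only one vertex (so $\kappa(\Gamma)=0$ if $\Gamma$ is already disconnected or has one vertex). $\Gamma$ is minimally connected if $\kappa(\Gamma-\epsilon)=\kappa(\Gamma)-1$ for every edge $\epsilon$ of $\Gamma$, where $\Gamma-\epsilon$ is $\Gamma$ with the edge $\epsilon$ removed (all vertices kept). *)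

theory Defs
  imports "HOL-Computational_Algebra.Primes" "HOL-Algebra.Multiplicative_Group" "Graph_Theory.Digraph_Component"
begin

text \<open>
  As in Graph\_Theory, a finite simple undirected graph is a loop-free symmetric digraph
  (locale \<^locale>\<open>pair_graph\<close>): the edge between \<open>u\<close> and \<open>v\<close> is the pair of arcs
  \<open>(u, v)\<close>, \<open>(v, u)\<close>.
\<close>

definition order_superpower_graph :: "('a, 'm) monoid_scheme \<Rightarrow> 'a pair_pre_digraph" where
  "order_superpower_graph G =
     \<lparr> pverts = carrier G,
       parcs = {(x, y). x \<in> carrier G \<and> y \<in> carrier G \<and> x \<noteq> y \<and>
                  (group.ord G x dvd group.ord G y \<or> group.ord G y dvd group.ord G x)} \<rparr>"

lemma pair_graph_order_superpower_graph:
  assumes "finite (carrier G)"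
  shows "pair_graph (order_superpower_graph G)"
proof
  show "finite (parcs (order_superpower_graph G))"
    by (rule finite_subset[OF _ finite_cartesian_product[OF assms assms]])
      (auto simp: order_superpower_graph_def)
  show "symmetric (with_proj (order_superpower_graph G))"
    by (auto simp: symmetric_def sym_def arcs_ends_def arc_to_ends_def order_superpower_graph_def)
qed (use assms in \<open>auto simp: order_superpower_graph_def\<close>)

definition delete_vertices :: "'a pair_pre_digraph \<Rightarrow> 'a set \<Rightarrow> ('a, 'a \<times> 'a) pre_digraph" where
  "delete_vertices \<Gamma> S = induce_subgraph (with_proj \<Gamma>) (pverts \<Gamma> - S)"

definition delete_edge :: "'a pair_pre_digraph \<Rightarrow> 'a \<times> 'a \<Rightarrow> 'a pair_pre_digraph" where
  "delete_edge \<Gamma> e = \<Gamma> \<lparr> parcs := parcs \<Gamma> - {e, prod.swap e} \<rparr>"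

lemma pair_graph_delete_edge:
  assumes "pair_graph \<Gamma>"
  shows "pair_graph (delete_edge \<Gamma> e)"
proof -
  interpret pair_graph \<Gamma> by fact
  have "sym (parcs \<Gamma>)"
    using pair_sym_arcs by (simp add: symmetric_def)
  then have "sym (parcs (delete_edge \<Gamma> e))"
    by (auto simp: delete_edge_def sym_def prod.swap_def)
  then show ?thesis
    by unfold_locales
      (auto simp: delete_edge_def symmetric_def arcs_ends_def arc_to_ends_def
        dest: arc_fst_in_verts arc_snd_in_verts pair_no_loops)
qed

text \<open>
  The library counts the empty graph as not connected, so \<open>S = pverts \<Gamma>\<close> is always admissible
  below. It never attains the minimum for a finite nonempty \<open>\<Gamma>\<close>, where removing all vertices
  but one is also admissible. The name \<open>connected\<close> is qualified because of topological
  connectedness.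
\<close>

definition vertex_connectivity :: "'a pair_pre_digraph \<Rightarrow> nat" where
  "vertex_connectivity \<Gamma> =
     (LEAST k. \<exists>S \<subseteq> pverts \<Gamma>. card S = k \<and>
        (\<not> Digraph_Component.connected (delete_vertices \<Gamma> S) \<or>
         card (verts (delete_vertices \<Gamma> S)) = 1))"

text \<open>
  The subtraction is on integers: a disconnected graph that has an edge is not minimally
  connected.
\<close>

definition minimally_connected :: "'a pair_pre_digraph \<Rightarrow> bool" where
  "minimally_connected \<Gamma> \<longleftrightarrow>
     (\<forall>e \<in> parcs \<Gamma>.
        int (vertex_connectivity (delete_edge \<Gamma> e)) = int (vertex_connectivity \<Gamma>) - 1)"

definition p_group :: "nat \<Rightarrow> ('a, 'm) monoid_scheme \<Rightarrow> bool" where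
  "p_group p G \<longleftrightarrow>
     prime p \<and> group G \<and> finite (carrier G) \<and> (\<exists>n. order G = p ^ n)"

end

theory Submission
  imports Defs "HOL-Algebra.Sylow"
begin

text \<open>
  If \<open>G\<close> is a \<open>p\<close>-group, its order superpower graph is complete, and deleting an edge
  of a complete graph lowers the connectivity by one. Otherwise \<open>G\<close> has an element \<open>x\<close> of odd
  prime order and an element of another prime order, not adjacent to \<open>x\<close>. The vertices \<open>x\<close> and
  \<open>x\<inverse>\<close> are distinct twins. Deleting the edge between them does not lower the connectivity: a set
  separating them contains all their common neighbours, and these already separate the pair
  from the rest of the graph.
\<close>

section \<open>Vertex cuts and vertex connectivity\<close>

definition vertex_cut :: "'a pair_pre_digraph \<Rightarrow> 'a set \<Rightarrow> bool" where
  "vertex_cut \<Gamma> S \<longleftrightarrow> S \<subseteq> pverts \<Gamma> \<and>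
     (\<not> Digraph_Component.connected (delete_vertices \<Gamma> S) \<or> card (pverts \<Gamma> - S) = 1)"

lemma vertex_connectivity_eq_Least:
  "vertex_connectivity \<Gamma> = (LEAST k. \<exists>S. card S = k \<and> vertex_cut \<Gamma> S)"
  unfolding vertex_connectivity_def vertex_cut_def delete_vertices_def
  by (rule arg_cong[where f = Least]) auto

lemma vertex_connectivity_le: "vertex_cut \<Gamma> S \<Longrightarrow> vertex_connectivity \<Gamma> \<le> card S"
  unfolding vertex_connectivity_eq_Least by (rule Least_le) auto

text \<open>Walks that \<open>rtrancl_on\<close> confines to the remaining vertices use only arcs
  between those, and symmetry of \<open>parcs \<Gamma>\<close> means that \<open>symcl\<close> adds
  nothing. Later arguments can then work with walks alone.\<close>

lemma connected_delete_vertices_iff: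
  assumes "pair_graph \<Gamma>"
  shows "Digraph_Component.connected (delete_vertices \<Gamma> S) \<longleftrightarrow>
    pverts \<Gamma> - S \<noteq> {} \<and>
    (\<forall>u \<in> pverts \<Gamma> - S. \<forall>v \<in> pverts \<Gamma> - S. (u, v) \<in> rtrancl_on (pverts \<Gamma> - S) (parcs \<Gamma>))"
proof -
  interpret pair_graph \<Gamma> by fact
  let ?F = "pverts \<Gamma> - S"
  let ?R = "parcs \<Gamma> \<inter> ?F \<times> ?F"
  have "sym (parcs \<Gamma>)"
    using pair_sym_arcs by (simp add: symmetric_def)
  then have "symcl (arcs_ends (delete_vertices \<Gamma> S)) = ?R"
    by (auto simp: symcl_def delete_vertices_def arcs_ends_def arc_to_ends_def sym_def image_iff)
  moreover have "(u, v) \<in> rtrancl_on ?F ?R \<longleftrightarrow> (u, v) \<in> rtrancl_on ?F (parcs \<Gamma>)" for u v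
  proof
    assume "(u, v) \<in> rtrancl_on ?F (parcs \<Gamma>)"
    then show "(u, v) \<in> rtrancl_on ?F ?R"
      by induction (auto intro: converse_rtrancl_on_into_rtrancl_on)
  qed (auto intro: rtrancl_on_mono[rotated 2])
  ultimately show ?thesis
    by (simp add: connected_conv delete_vertices_def)
qed

text \<open>The empty graph counts as not connected. Hence the \<open>LEAST\<close> in
  \<open>vertex_connectivity\<close> ranges over a nonempty set and is attained.\<close>

lemma vertex_cut_all:
  assumes "pair_graph \<Gamma>"
  shows "vertex_cut \<Gamma> (pverts \<Gamma>)"
  using connected_delete_vertices_iff[OF assms] by (simp add: vertex_cut_def)

lemma obtain_minimum_vertex_cut:
  assumes "pair_graph \<Gamma>"
  obtains S where "vertex_cut \<Gamma> S" and "card S = vertex_connectivity \<Gamma>"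
proof -
  have "\<exists>S. card S = card (pverts \<Gamma>) \<and> vertex_cut \<Gamma> S"
    using vertex_cut_all[OF assms] by blast
  then have "\<exists>S. card S = vertex_connectivity \<Gamma> \<and> vertex_cut \<Gamma> S"
    unfolding vertex_connectivity_eq_Least by (rule LeastI)
  then show ?thesis using that by blast
qed

text \<open>By \<open>closed\<close>, a walk from \<open>u\<close> that avoids \<open>S\<close>
  never leaves \<open>C\<close>, so it misses \<open>v\<close>.\<close>

lemma vertex_cut_isolating:
  assumes "pair_graph \<Gamma>" and "S \<subseteq> pverts \<Gamma>"
    and "u \<in> C" and "C \<subseteq> pverts \<Gamma> - S" and "v \<in> pverts \<Gamma> - S" and "v \<notin> C"
    and closed: "\<And>a b. a \<in> C \<Longrightarrow> (a, b) \<in> parcs \<Gamma> \<Longrightarrow> b \<in> C \<union> S"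
  shows "vertex_cut \<Gamma> S"
proof -
  have "b \<in> C" if "(u, b) \<in> rtrancl_on (pverts \<Gamma> - S) (parcs \<Gamma>)" for b
    using that by (induction rule: rtrancl_on_induct) (use assms in auto)
  then have "(u, v) \<notin> rtrancl_on (pverts \<Gamma> - S) (parcs \<Gamma>)"
    using \<open>v \<notin> C\<close> by blast
  then show ?thesis
    using assms connected_delete_vertices_iff[OF \<open>pair_graph \<Gamma>\<close>] by (auto simp: vertex_cut_def)
qed

text \<open>Vertices in different components have no walk of length at most two between them. In a
  complete graph with at most one edge deleted, this alone is contradictory once enough vertices
  remain.\<close>

lemma vertex_cut_nonadjacent:
  assumes \<Gamma>: "pair_graph \<Gamma>" and "vertex_cut \<Gamma> S" and "card (pverts \<Gamma> - S) \<noteq> 1"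
    and ne: "pverts \<Gamma> - S \<noteq> {}"
  obtains u v where "u \<in> pverts \<Gamma> - S" and "v \<in> pverts \<Gamma> - S" and "u \<noteq> v"
    and "(u, v) \<notin> parcs \<Gamma>"
    and "\<And>w. w \<in> pverts \<Gamma> - S \<Longrightarrow> (u, w) \<notin> parcs \<Gamma> \<or> (w, v) \<notin> parcs \<Gamma>"
proof -
  let ?F = "pverts \<Gamma> - S"
  have "\<not> Digraph_Component.connected (delete_vertices \<Gamma> S)"
    using assms by (simp add: vertex_cut_def)
  then obtain u v where uv: "u \<in> ?F" "v \<in> ?F" "(u, v) \<notin> rtrancl_on ?F (parcs \<Gamma>)"
    using ne connected_delete_vertices_iff[OF \<Gamma>] by blast
  have "(u, w) \<notin> parcs \<Gamma> \<or> (w, v) \<notin> parcs \<Gamma>" if "w \<in> ?F" for w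
    using uv that by (meson rtrancl_on.intros)
  moreover have "u \<noteq> v" and "(u, v) \<notin> parcs \<Gamma>"
    using uv by (meson rtrancl_on.intros)+
  ultimately show ?thesis using that uv by blast
qed

section \<open>Complete graphs and the deletion of one of their edges\<close>

locale complete_pair_graph = pair_graph +
  assumes adjacent_iff:
    "u \<in> pverts G \<Longrightarrow> v \<in> pverts G \<Longrightarrow> (u, v) \<in> parcs G \<longleftrightarrow> u \<noteq> v"
begin

text \<open>Removing all vertices but one gives the upper bound. For the lower bound, two remaining
  vertices would be adjacent, so every cut leaves at most one.\<close>

lemma vertex_connectivity_complete:
  assumes "pverts G \<noteq> {}"
  shows "vertex_connectivity G = card (pverts G) - 1"
proof (rule antisym)
  obtain u where u: "u \<in> pverts G"
    using assms by blast
  then have "pverts G - (pverts G - {u}) = {u}" by blast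
  then have "vertex_cut G (pverts G - {u})"
    by (simp add: vertex_cut_def)
  from vertex_connectivity_le[OF this] u show "vertex_connectivity G \<le> card (pverts G) - 1"
    by simp
  obtain S where S: "vertex_cut G S" "card S = vertex_connectivity G"
    using obtain_minimum_vertex_cut[OF pair_graph] .
  \<comment> \<open>The value 0 is allowed: the whole vertex set is a cut as well.\<close>
  have "card (pverts G - S) \<le> 1"
  proof (rule ccontr)
    assume *: "\<not> ?thesis"
    then have "pverts G - S \<noteq> {}" by force
    with * show False
      using vertex_cut_nonadjacent[OF pair_graph S(1)] adjacent_iff
      by (metis DiffD1 order_refl)
  qed
  moreover have "card (pverts G - S) = card (pverts G) - card S"
    using S by (intro card_Diff_subset) (auto simp: vertex_cut_def intro: finite_subset)
  ultimately show "card (pverts G) - 1 \<le> vertex_connectivity G"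
    using S by simp
qed

text \<open>Leaving just the two ends of \<open>e\<close> disconnects the graph. With three or more
  vertices left, a nonadjacent pair must be these ends, and any third vertex joins them.\<close>

lemma vertex_connectivity_complete_delete_edge:
  assumes "e \<in> parcs G"
  shows "vertex_connectivity (delete_edge G e) = card (pverts G) - 2"
proof (rule antisym)
  let ?H = "delete_edge G e"
  have H: "pair_graph ?H"
    using pair_graph by (rule pair_graph_delete_edge)
  obtain a b where e: "e = (a, b)" by fastforce
  have VH: "pverts ?H = pverts G" and AH: "parcs ?H = parcs G - {(a, b), (b, a)}"
    by (simp_all add: delete_edge_def e)
  with assms have ab: "a \<in> pverts G" "b \<in> pverts G" "a \<noteq> b"
    using in_arcsD1[of a b] in_arcsD2[of a b] pair_no_loops[of "(a, b)"] e by simp_all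
  have "vertex_cut ?H (pverts G - {a, b})"
    by (rule vertex_cut_isolating[OF H, of _ a "{a}" b])
      (use ab in \<open>auto simp: VH AH dest: in_arcsD2\<close>)
  from vertex_connectivity_le[OF this] ab show "vertex_connectivity ?H \<le> card (pverts G) - 2"
    by (simp add: card_Diff_subset)
  obtain S where S: "vertex_cut ?H S" "card S = vertex_connectivity ?H"
    using obtain_minimum_vertex_cut[OF H] .
  have "card (pverts G - S) \<le> 2"
  proof (rule ccontr)
    assume large: "\<not> ?thesis"
    then have "card (pverts G - S) \<noteq> 0" "card (pverts G - S) \<noteq> 1" by linarith+
    then have "pverts G - S \<noteq> {}" by (metis card.empty)
    with \<open>card (pverts G - S) \<noteq> 1\<close>
    obtain u v where uv: "u \<in> pverts G - S" "v \<in> pverts G - S" "u \<noteq> v" "(u, v) \<notin> parcs ?H"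
      and w: "\<And>w. w \<in> pverts G - S \<Longrightarrow> (u, w) \<notin> parcs ?H \<or> (w, v) \<notin> parcs ?H"
      using vertex_cut_nonadjacent[OF H S(1)] unfolding VH by metis
    then have "{u, v} = {a, b}"
      using adjacent_iff by (auto simp: AH)
    have "\<not> pverts G - S \<subseteq> {u, v}"
      using large card_mono[of "{u, v}" "pverts G - S"] uv by auto
    then obtain c where c: "c \<in> pverts G - S" "c \<noteq> u" "c \<noteq> v" by blast
    then have "(u, c) \<in> parcs ?H" "(c, v) \<in> parcs ?H"
      using uv adjacent_iff \<open>{u, v} = {a, b}\<close> by (auto simp: AH doubleton_eq_iff)
    with w c show False by blast
  qed
  moreover have "card (pverts G - S) = card (pverts G) - card S"
    using S by (intro card_Diff_subset) (auto simp: vertex_cut_def VH intro: finite_subset)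
  ultimately show "card (pverts G) - 2 \<le> vertex_connectivity ?H"
    using S by simp
qed

lemma minimally_connected_complete: "minimally_connected G"
  unfolding minimally_connected_def
proof
  fix e assume e: "e \<in> parcs G"
  then have "{fst e, snd e} \<subseteq> pverts G" "fst e \<noteq> snd e"
    using arc_fst_in_verts arc_snd_in_verts pair_no_loops by auto
  \<comment> \<open>With two vertices present, neither \<open>card (pverts G) - 1\<close> nor
    \<open>card (pverts G) - 2\<close> is truncated, so they differ by exactly one.\<close>
  then have "2 \<le> card (pverts G)"
    using card_mono[of "pverts G" "{fst e, snd e}"] by simp
  moreover from this have "pverts G \<noteq> {}" by auto
  ultimately show "int (vertex_connectivity (delete_edge G e)) = int (vertex_connectivity G) - 1"
    using e by (simp add: vertex_connectivity_complete vertex_connectivity_complete_delete_edge)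
qed

end

section \<open>Deleting the edge between twin vertices\<close>

text \<open>A minimum cut \<open>S\<close> after the deletion yields a cut of
  \<open>\<Gamma>\<close> that is no larger: the set of common neighbours of the twins if
  \<open>S\<close> contains it, and \<open>S\<close> itself otherwise.\<close>

lemma vertex_connectivity_delete_twin_edge:
  assumes \<Gamma>: "pair_graph \<Gamma>" and edge: "(x, x') \<in> parcs \<Gamma>"
    and twins: "\<And>z. z \<noteq> x \<Longrightarrow> z \<noteq> x' \<Longrightarrow> (x, z) \<in> parcs \<Gamma> \<longleftrightarrow> (x', z) \<in> parcs \<Gamma>"
    and y: "y \<in> pverts \<Gamma>" "y \<noteq> x" "(x, y) \<notin> parcs \<Gamma>"
  shows "vertex_connectivity \<Gamma> \<le> vertex_connectivity (delete_edge \<Gamma> (x, x'))"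
proof -
  interpret pair_graph \<Gamma> by fact
  let ?H = "delete_edge \<Gamma> (x, x')"
  have H: "pair_graph ?H"
    using \<Gamma> by (rule pair_graph_delete_edge)
  have VH: "pverts ?H = pverts \<Gamma>" and AH: "parcs ?H = parcs \<Gamma> - {(x, x'), (x', x)}"
    by (simp_all add: delete_edge_def)
  have sym: "(b, a) \<in> parcs \<Gamma>" if "(a, b) \<in> parcs \<Gamma>" for a b
    using pair_sym_arcs that by (auto simp: symmetric_def sym_def)
  have irrefl: "a \<noteq> b" if "(a, b) \<in> parcs \<Gamma>" for a b
    using pair_no_loops[OF that] by simp
  obtain S where S: "vertex_cut ?H S" "card S = vertex_connectivity ?H"
    using obtain_minimum_vertex_cut[OF H] .
  \<comment> \<open>By \<open>twins\<close>, these are exactly the common neighbours of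
    \<open>x\<close> and \<open>x'\<close>.\<close>
  define N where "N = {z. (x, z) \<in> parcs \<Gamma>} - {x'}"
  have fin: "finite S"
    using S by (auto simp: vertex_cut_def VH intro: finite_subset)
  show ?thesis
  proof (cases "N \<subseteq> S")
    case True
    \<comment> \<open>Since \<open>y\<close> is not adjacent to \<open>x\<close>, it lies outside
      \<open>N\<close> and differs from \<open>x'\<close>. So \<open>N\<close> cuts
      \<open>{x, x'}\<close> off from \<open>y\<close>.\<close>
    have "vertex_cut \<Gamma> N"
      by (rule vertex_cut_isolating[OF \<Gamma>, of _ x "{x, x'}" y])
        (use edge y twins in \<open>auto simp: N_def dest: in_arcsD1 in_arcsD2 irrefl\<close>)
    then have "vertex_connectivity \<Gamma> \<le> card N"
      by (rule vertex_connectivity_le)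
    also have "\<dots> \<le> card S"
      using True fin by (rule card_mono[rotated])
    finally show ?thesis using S by simp
  next
    case False
    then obtain z where z: "(x, z) \<in> parcs \<Gamma>" "z \<noteq> x'" "z \<notin> S"
      by (auto simp: N_def)
    then have "z \<noteq> x" using irrefl by blast
    with z have z': "(x', z) \<in> parcs \<Gamma>" "z \<noteq> x" "z \<in> pverts \<Gamma>"
      using twins in_arcsD2 by blast+
    let ?F = "pverts \<Gamma> - S"
    \<comment> \<open>Only the deleted edge is missing in \<open>?H\<close>; the path through the
      surviving common neighbour \<open>z\<close> bypasses it.\<close>
    have step: "(a, b) \<in> rtrancl_on ?F (parcs ?H)"
      if "(a, b) \<in> parcs \<Gamma>" "a \<in> ?F" "b \<in> ?F" for a b
    proof (cases "(a, b) \<in> parcs ?H")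
      case True
      then show ?thesis using that by (meson rtrancl_on.intros)
    next
      case False
      then have "(a, z) \<in> parcs ?H" "(z, b) \<in> parcs ?H"
        using that z z' sym by (auto simp: AH)
      then show ?thesis using that z z' by (meson DiffI rtrancl_on.intros)
    qed
    have "(a, b) \<in> rtrancl_on ?F (parcs ?H)" if "(a, b) \<in> rtrancl_on ?F (parcs \<Gamma>)" for a b
      using that by induction (auto intro: step rtrancl_on_trans)
    then have "Digraph_Component.connected (delete_vertices ?H S)"
      if "Digraph_Component.connected (delete_vertices \<Gamma> S)"
      using that by (simp add: connected_delete_vertices_iff \<Gamma> H VH)
    \<comment> \<open>The other way to be a cut, leaving one vertex, depends only on the vertex set,
      which both graphs share.\<close>
    then have "vertex_cut \<Gamma> S"
      using S(1) by (auto simp: vertex_cut_def VH)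
    then show ?thesis using vertex_connectivity_le S by metis
  qed
qed

section \<open>Element orders and \<open>p\<close>-groups\<close>

text \<open>Cauchy's theorem, from Sylow with exponent 1: a subgroup \<open>H\<close> of order
  \<open>p\<close> has a nonidentity element, whose order divides \<open>p\<close> by Lagrange in
  \<open>H\<close>.\<close>

lemma (in group) ord_prime_if_dvd_order:
  assumes "finite (carrier G)" and "prime p" and "p dvd order G"
  shows "\<exists>x \<in> carrier G. ord x = p"
proof -
  \<comment> \<open>Here \<open>p\<close> may still divide \<open>m\<close>.\<close>
  obtain m where "order G = p ^ 1 * m" using assms by auto
  then obtain H where H: "subgroup H G" "card H = p"
    using sylow_thm[OF \<open>prime p\<close> is_group _ \<open>finite (carrier G)\<close>, of 1 m] by auto
  then have "H \<noteq> {\<one>}"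
    using \<open>prime p\<close> by (auto dest: prime_gt_1_nat)
  then obtain x where x: "x \<in> H" "x \<noteq> \<one>"
    using H(1) subgroup.one_closed by blast
  then have "x \<in> carrier G" using H subgroup.subset by blast
  moreover have "ord x dvd p"
  proof -
    interpret H: group "G\<lparr>carrier := H\<rparr>" using H subgroup.subgroup_is_group is_group by blast
    have "x [^]\<^bsub>G\<lparr>carrier := H\<rparr>\<^esub> p = \<one>"
      using H.pow_order_eq_1[of x] x H by (simp add: order_def)
    then show ?thesis
      using \<open>x \<in> carrier G\<close> by (simp add: pow_eq_id nat_pow_consistent[symmetric])
  qed
  ultimately show ?thesis
    using x \<open>prime p\<close> ord_eq_1 by (metis One_nat_def prime_nat_iff)
qed

text \<open>Element orders divide a power of \<open>p\<close>, hence are powers of \<open>p\<close>,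
  and of two such powers one divides the other.\<close>

lemma p_group_imp_complete_pair_graph:
  assumes "p_group p G"
  shows "complete_pair_graph (order_superpower_graph G)"
proof -
  interpret group G using assms by (simp add: p_group_def)
  have fin: "finite (carrier G)" and p: "prime p" using assms by (auto simp: p_group_def)
  obtain n where n: "order G = p ^ n" using assms by (auto simp: p_group_def)
  have "ord x dvd ord y \<or> ord y dvd ord x" if "x \<in> carrier G" "y \<in> carrier G" for x y
  proof -
    have "ord x dvd p ^ n" "ord y dvd p ^ n"
      using ord_dvd_group_order that n by metis+
    then obtain i j where "ord x = p ^ i" "ord y = p ^ j"
      using p by (auto simp: divides_primepow_nat)
    then show ?thesis using le_imp_power_dvd nle_le by metis
  qed
  then show ?thesis
    using pair_graph_order_superpower_graph[OF fin]
    by (auto simp: complete_pair_graph_def complete_pair_graph_axioms_def order_superpower_graph_def)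
qed

text \<open>Supplies the orders of two nonadjacent vertices; \<open>2 < p\<close> will make an
  element of order \<open>p\<close> differ from its inverse.\<close>

lemma (in group) two_primes_if_not_p_group:
  assumes fin: "finite (carrier G)" and "\<nexists>p. p_group p G"
  obtains p q where "prime p" "prime q" "p \<noteq> q" "2 < p" "p dvd order G" "q dvd order G"
proof -
  have not_power: "order G \<noteq> p ^ n" if "prime p" for p n
    using assms that by (auto simp: p_group_def is_group)
  \<comment> \<open>The trivial group has order \<open>2 ^ 0\<close>, so it counts as a
    \<open>p\<close>-group.\<close>
  have "order G \<noteq> 1" using not_power[of 2 0] by simp
  then obtain p where p: "prime p" "p dvd order G"
    using prime_factor_nat by blast
  have "\<exists>q. prime q \<and> q dvd order G \<and> q \<noteq> p"
  proof -
    \<comment> \<open>Once the full power of \<open>p\<close> is divided out, every prime factor of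
      the cofactor differs from \<open>p\<close>.\<close>
    obtain m k where mk: "order G = p ^ k * m" "\<not> p dvd m"
      using divide_out_primepow_ex[of "order G" "\<lambda>q. q = p"] p order_gt_0_iff_finite fin
      by (metis mult.commute multiplicity_decompose' not_prime_unit not_gr_zero)
    then have "m \<noteq> 1" using not_power[OF p(1), of k] by auto
    then obtain q where "prime q" "q dvd m" using prime_factor_nat by blast
    then show ?thesis using mk by (intro exI[of _ q]) auto
  qed
  then obtain q where q: "prime q" "q dvd order G" "q \<noteq> p" by blast
  show ?thesis
  proof (cases "2 < p")
    case True
    then show ?thesis using p q that by blast
  next
    case False
    \<comment> \<open>Now \<open>p\<close> is 2, so the two primes swap roles.\<close>
    then have "2 < q"
      using p(1) q(1,3) prime_ge_2_nat by (metis le_antisym not_le)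
    then show ?thesis using p q that by blast
  qed
qed

theorem theorem2p10:
  fixes G (structure)
  assumes "group G" and "finite (carrier G)"
  shows "minimally_connected (order_superpower_graph G) \<longleftrightarrow> (\<exists>p. p_group p G)"
proof
  assume "\<exists>p. p_group p G"
  then show "minimally_connected (order_superpower_graph G)"
    using p_group_imp_complete_pair_graph complete_pair_graph.minimally_connected_complete by blast
next
  interpret group G by fact
  let ?\<Gamma> = "order_superpower_graph G"
  assume mc: "minimally_connected ?\<Gamma>"
  show "\<exists>p. p_group p G"
  proof (rule ccontr)
    assume "\<nexists>p. p_group p G"
    then obtain p q where pq: "prime p" "prime q" "p \<noteq> q" "2 < p" "p dvd order G" "q dvd order G"
      using two_primes_if_not_p_group \<open>finite (carrier G)\<close> by metis
    obtain x y where xy: "x \<in> carrier G" "ord x = p" "y \<in> carrier G" "ord y = q"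
      using ord_prime_if_dvd_order[OF \<open>finite (carrier G)\<close>] pq by metis
    have "inv x \<noteq> x"
    proof
      assume "inv x = x"
      then have "x [^] (2::nat) = \<one>"
        using xy by (metis l_inv nat_pow_closed nat_pow_0 nat_pow_Suc numeral_2_eq_2 l_one)
      then have "p dvd 2" using xy pow_eq_id by metis
      with pq show False by (auto dest: dvd_imp_le)
    qed
    \<comment> \<open>\<open>x\<close> and \<open>inv x\<close> have the same order, and adjacency
      of distinct vertices depends only on orders, so they are adjacent twins.\<close>
    then have edge: "(x, inv x) \<in> parcs ?\<Gamma>"
      using xy by (auto simp: order_superpower_graph_def)
    have "vertex_connectivity ?\<Gamma> \<le> vertex_connectivity (delete_edge ?\<Gamma> (x, inv x))"
    proof (rule vertex_connectivity_delete_twin_edge)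
      show "pair_graph ?\<Gamma>"
        using \<open>finite (carrier G)\<close> by (rule pair_graph_order_superpower_graph)
      show "(x, y) \<notin> parcs ?\<Gamma>"
        using xy pq by (auto simp: order_superpower_graph_def dest: primes_dvd_imp_eq)
    qed (use xy pq edge in \<open>auto simp: order_superpower_graph_def\<close>)
    moreover have "int (vertex_connectivity (delete_edge ?\<Gamma> (x, inv x))) = int (vertex_connectivity ?\<Gamma>) - 1"
      using mc edge unfolding minimally_connected_def by blast
    ultimately show False by linarith
  qed
qed

end
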